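(* There is a constant $\varepsilon > 0$ such that for all integers $n \ge k \ge 2$, any graph $G$ with vertex set $[n]=\{1,\dots,n\}$ with fewer than $\varepsilon \frac{n^2}{k^2 \log k}$ edges contains a $k$-term independent arithmetic progression.
   Context: $\log$ denotes the natural logarithm. Given a graph with vertex set $[n]$, a $k$-term arithmetic progression (a set $\{a, a+d, \dots, a+(k-1)d\} \subseteq [n]$ with $d \geq 1$) is independent if it is an independent set in the graph. *)

theory Defs
  imports Complex_Main "HOL-Library.Ramsey"
begin

definition arith_progression :: "nat \<Rightarrow> nat set \<Rightarrow> bool" where
  "arith_progression k A \<longleftrightarrow> (\<exists>a d. d \<ge> 1 \<and> A = {a + i * d | i. i < k})"

text \<open>A simple graph with vertex set \<open>V\<close> is given by its edge set \<open>E \<subseteq> nsets V 2\<close>, as in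
  \<^theory>\<open>HOL-Library.Ramsey\<close>, whose predicate \<^const>\<open>indep\<close> takes the vertex subset first and the
  edge set second.\<close>

definition independent_progression :: "nat \<Rightarrow> nat \<Rightarrow> nat set set \<Rightarrow> nat set \<Rightarrow> bool" where
  "independent_progression n k E A \<longleftrightarrow> arith_progression k A \<and> A \<subseteq> {1..n} \<and> indep A E"

end

theory Submission
  imports Defs "HOL-Number_Theory.Prime_Powers" "HOL-Analysis.Harmonic_Numbers"
begin

text \<open>
  The proof is a double count of progressions and the edges they contain. There are about \<open>n^2 / k\<close>
  progressions of \<open>k\<close> terms in \<open>{1..n}\<close>. An edge \<open>{x, y}\<close> with \<open>D = y - x\<close> lies in at most
  \<open>k\<close> progressions for each common difference \<open>d\<close> that divides \<open>D\<close> with a quotient below \<open>k\<close>.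
  If there were \<open>O(ln k)\<close> such differences for each \<open>D\<close>, then about \<open>n^2 / (k^2 ln k)\<close> edges
  would be necessary to meet all progressions. But some \<open>D\<close> have many more divisors of
  this kind, and so the count is restricted to, or weighted towards, differences with few
  coincidences (\<open>exists_difference_weights\<close>). With \<open>m = n div (2 k)\<close> the largest difference in use,
  the weights are required to have mass of order \<open>m / ln k\<close> on \<open>{1..m}\<close> and mass at most 1 on
  the differences that are relevant to a single \<open>D\<close>. Then
  \<open>edges_ge_if_no_independent_progression\<close> gives the theorem.

  For \<open>m \<le> k^24\<close> the weights are the von Mangoldt function \<open>\<Lambda>\<close> over a multiple of \<open>ln k\<close>. The sum of
  \<open>\<Lambda>\<close> over the divisors of \<open>D\<close> is \<open>ln D = O(ln k)\<close>, and its sum up to \<open>m\<close> has order \<open>m\<close> by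
  Chebyshev's bound (\<open>chebyshev_lower\<close>).

  For \<open>m > k^24\<close> only the \<open>k\<close>-rough differences are used, those without prime factors below \<open>k\<close>.
  If \<open>D = d j\<close> with \<open>d\<close> rough and \<open>j < k\<close>, then \<open>d\<close> is the rough part of \<open>D\<close>, so each \<open>D\<close>
  has at most one difference of this kind (\<open>rough_factor_unique\<close>). It remains to see that the
  rough numbers up to \<open>m\<close> have the expected density of order \<open>1 / ln k\<close> (\<open>card_rough_ge\<close>). This
  follows from three elementary estimates. The sum of \<open>1/f\<close> over smooth numbers is \<open>O(ln k)\<close> (\<open>sum_reciprocal_smooth_le\<close>); as each integer is a rough number times a smooth
  one, the sum of \<open>1/e\<close> over rough \<open>e \<le> y\<close> has order at least \<open>ln y / ln k\<close>
  (\<open>sum_reciprocal_rough_ge\<close>); and Chebyshev's identity, applied to the rough numbers alone, turns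
  this logarithmic density into a count.
\<close>

section \<open>Legendre's formula and Chebyshev's lower bound\<close>

text \<open>Legendre's formula in logarithmic form. Passing from \<open>N\<close> to \<open>N + 1\<close> raises the floor
  \<open>N div d\<close> by one exactly when \<open>d\<close> divides \<open>N + 1\<close>, so the right-hand side grows by the sum
  of the von Mangoldt function over the divisors of \<open>N + 1\<close>, which is \<open>ln (N + 1)\<close>.\<close>

lemma ln_fact_eq_sum_mangoldt:
  "ln (fact N) = (\<Sum>d=1..N. mangoldt d * real (N div d))"
proof (induction N)
  case 0
  then show ?case by simp
next
  case (Suc N)
  have "(\<Sum>d=1..Suc N. mangoldt d * real (Suc N div d))
      = (\<Sum>d=1..Suc N. mangoldt d * real (N div d) + (if d dvd Suc N then mangoldt d else 0))"
    by (intro sum.cong refl) (auto simp: div_Suc dvd_eq_mod_eq_0 algebra_simps)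
  also have "\<dots> = (\<Sum>d=1..Suc N. mangoldt d * real (N div d))
      + (\<Sum>d=1..Suc N. if d dvd Suc N then mangoldt d else 0)"
    by (rule sum.distrib)
  also have "(\<Sum>d=1..Suc N. mangoldt d * real (N div d)) = ln (fact N)"
    using Suc by simp
  also have "(\<Sum>d=1..Suc N. if d dvd Suc N then mangoldt d else 0) = (\<Sum>d | d dvd Suc N. mangoldt d)"
    by (subst sum.inter_filter [symmetric])
       (auto intro!: sum.cong dest: dvd_imp_le simp: Suc_le_eq intro: Nat.gr0I)
  also have "\<dots> = ln (real (Suc N))"
    using mangoldt_sum[of "Suc N", where ?'a=real] by simp
  also have "ln (fact N) + ln (real (Suc N)) = ln (fact (Suc N))"
    by (simp add: ln_mult)
  finally show ?case by simp
qed

lemma four_power_le_central_binomial: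
  assumes "n \<ge> 1"
  shows "4 ^ n \<le> 2 * n * ((2 * n) choose n)"
  using assms
proof (induction n rule: dec_induct)
  case base
  then show ?case by (simp add: choose_two numeral_2_eq_2)
next
  case (step n)
  have "Suc n * ((2 * Suc n) choose Suc n) = 2 * (2 * n + 1) * ((2 * n) choose n)"
  proof -
    have a: "Suc n * (Suc (2*n+1) choose Suc n) = Suc (2*n+1) * ((2*n+1) choose n)"
      by (rule Suc_times_binomial)
    have b: "Suc n * (Suc (2*n) choose n) = Suc (2*n) * ((2*n) choose n)"
      using binomial_absorb_comp[of "Suc (2*n)" n] by (simp add: Suc_diff_le)
    have "Suc n * (Suc n * (Suc (2*n+1) choose Suc n)) = Suc n * (2 * (2 * n + 1) * ((2 * n) choose n))"
      using a b by (simp add: algebra_simps)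
    then have "Suc n * (Suc (2*n+1) choose Suc n) = 2 * (2 * n + 1) * ((2 * n) choose n)"
      by (metis mult_left_cancel nat.simps(3))
    then show ?thesis by simp
  qed
  then have "2 * Suc n * ((2 * Suc n) choose Suc n) = 4 * (2 * n + 1) * ((2 * n) choose n)"
    by linarith
  also have "\<dots> \<ge> 4 * (2 * n * ((2 * n) choose n))" by simp
  finally show ?case using step.IH by simp
qed

text \<open>Chebyshev's lower bound for \<open>\<psi>\<close>. By Legendre's formula the logarithm of the central binomial
  coefficient is a sum of values of the von Mangoldt function with weights
  \<open>2n div d - 2 (n div d)\<close>, all of which are at most 1; so it is at most \<open>\<psi>(2n)\<close>, while the
  coefficient itself is at least \<open>4^n / (2n)\<close>.\<close>

lemma chebyshev_lower:
  assumes "N \<ge> 2"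
  shows "real N / 6 \<le> (\<Sum>d=1..N. mangoldt d)"
proof -
  define n where "n = N div 2"
  have n: "n \<ge> 1" "2 * n \<le> N" "N \<le> 2 * n + 1" using assms by (auto simp: n_def)
  define c where "c = (2 * n) choose n"
  have c0: "c > 0" by (simp add: c_def)
  have "(4::real) ^ n \<le> 2 * n * c"
    using four_power_le_central_binomial[OF n(1)] unfolding c_def
    by (metis of_nat_le_iff of_nat_mult of_nat_numeral of_nat_power)
  then have "ln ((4::real) ^ n) \<le> ln (2 * real n * c)"
    using n c0 by (subst ln_le_cancel_iff) auto
  also have "\<dots> = ln 2 + ln (real n) + ln c" using n c0 by (simp add: ln_mult)
  finally have 1: "n * ln 4 \<le> ln 2 + ln (real n) + ln c" by (simp add: ln_realpow)
  have "ln (4::real) = 2 * ln 2" using ln_realpow[of "2::real" 2] by simp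
  with 1 have 1: "2 * n * ln 2 \<le> ln 2 + ln (real n) + ln c" by simp
  have 2: "ln (real n) \<le> real n - 1" using n by (intro ln_le_minus_one) auto
  have "real (fact (2 * n)) = fact n * fact n * c"
    using binomial_fact_lemma[of n "2*n"] by (metis c_def diff_add_inverse2 le_add2 mult_2 of_nat_fact of_nat_mult)
  then have "ln (fact (2 * n) :: real) = ln (fact n) + ln (fact n) + ln c"
    using c0 by (simp add: ln_mult)
  then have "ln c = ln (fact (2 * n)) - 2 * ln (fact n)" by simp
  also have "ln (fact n) = (\<Sum>d=1..2*n. mangoldt d * real (n div d))"
    unfolding ln_fact_eq_sum_mangoldt by (intro sum.mono_neutral_left) auto
  also have "ln (fact (2 * n)) - 2 * (\<Sum>d=1..2*n. mangoldt d * real (n div d))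
     = (\<Sum>d=1..2*n. mangoldt d * (real (2 * n div d) - 2 * real (n div d)))"
    unfolding ln_fact_eq_sum_mangoldt by (simp add: sum_subtractf sum_distrib_left algebra_simps)
  also have "\<dots> \<le> (\<Sum>d=1..2*n. mangoldt d)"
  proof (intro sum_mono)
    fix d assume d: "d \<in> {1..2*n}"
    have "2 * n div d < 2 * (n div d) + 2"
      using d dividend_less_times_div[of d n]
      by (subst div_less_iff_less_mult) (auto simp: algebra_simps)
    then have "real (2 * n div d) - 2 * real (n div d) \<le> 1" by linarith
    then show "mangoldt d * (real (2 * n div d) - 2 * real (n div d)) \<le> (mangoldt d :: real)"
      by (metis mangoldt_nonneg mult_left_mono mult.right_neutral)
  qed
  also have "\<dots> \<le> (\<Sum>d=1..N. mangoldt d)"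
    using n by (intro sum_mono2) (auto simp: mangoldt_nonneg)
  finally have 3: "ln c \<le> (\<Sum>d=1..N. mangoldt d)" .
  have "(2 * real n - 1) * (2/3) \<le> (2 * real n - 1) * ln 2"
    using n ln2_ge_two_thirds by (intro mult_left_mono) auto
  with 1 2 3 n have "real n / 3 + 1 / 3 \<le> (\<Sum>d=1..N. mangoldt d)"
    by (simp add: algebra_simps)
  then show ?thesis using n by linarith
qed

text \<open>A weak form of Mertens' first theorem, with the constant 2 instead of \<open>1 + o(1)\<close>. Legendre's
  formula for \<open>k!\<close> gives it at once, since \<open>k div p\<close> is at least half of \<open>k / p\<close>.\<close>

lemma sum_ln_prime_over_prime_le:
  assumes "k \<ge> 1"
  shows "(\<Sum>p | prime p \<and> p < k. ln (real p) / real p) \<le> 2 * ln (real k)"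
proof -
  let ?P = "{p. prime p \<and> p < k}"
  have "real k / 2 * (\<Sum>p\<in>?P. ln (real p) / real p) = (\<Sum>p\<in>?P. ln (real p) * (real k / (2 * real p)))"
    by (simp add: sum_distrib_left field_simps)
  also have "\<dots> \<le> (\<Sum>p\<in>?P. mangoldt p * real (k div p))"
  proof (intro sum_mono)
    fix p assume p: "p \<in> ?P"
    then have "p > 0" "k div p \<ge> 1" by (auto simp: prime_gt_0_nat div_greater_zero_iff Suc_le_eq)
    moreover have "k < p * (k div p + 1)"
      using \<open>p > 0\<close> dividend_less_times_div[of p k] by simp
    moreover have "p * (k div p + 1) \<le> p * (2 * (k div p))"
      using \<open>k div p \<ge> 1\<close> by (intro mult_le_mono2) linarith
    ultimately have "k \<le> p * (2 * (k div p))"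
      by linarith
    then have "real k \<le> real p * (2 * real (k div p))" by (metis of_nat_le_iff of_nat_mult of_nat_numeral)
    then have "real k / (2 * real p) \<le> real (k div p)"
      using \<open>p > 0\<close> by (simp add: field_simps)
    then have "ln (real p) * (real k / (2 * real p)) \<le> ln (real p) * real (k div p)"
      using \<open>p > 0\<close> by (intro mult_left_mono) auto
    then show "ln (real p) * (real k / (2 * real p)) \<le> mangoldt p * real (k div p)"
      using p by simp
  qed
  also have "\<dots> \<le> (\<Sum>d=1..k. mangoldt d * real (k div d))"
    by (intro sum_mono2) (auto simp: mangoldt_nonneg Suc_le_eq prime_gt_0_nat)
  also have "\<dots> = ln (fact k)" by (rule ln_fact_eq_sum_mangoldt [symmetric])
  also have "\<dots> \<le> ln (real k ^ k)"
    using fact_le_power[of k] assms by (subst ln_le_cancel_iff) auto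
  also have "\<dots> = real k * ln (real k)" using assms by (simp add: ln_realpow)
  finally show ?thesis using assms by (simp add: field_simps)
qed

section \<open>Rough and smooth numbers\<close>

text \<open>The usual rough and smooth numbers. The inequality is strict for smooth numbers, so that
  rough and smooth numbers are coprime and all \<open>j\<close> with \<open>0 < j < k\<close> are smooth. Zero, which
  would otherwise count as 2-rough, is excluded.\<close>

definition rough :: "nat \<Rightarrow> nat \<Rightarrow> bool" where
  "rough k n \<longleftrightarrow> n > 0 \<and> (\<forall>p. prime p \<longrightarrow> p dvd n \<longrightarrow> k \<le> p)"

definition smooth :: "nat \<Rightarrow> nat \<Rightarrow> bool" where
  "smooth k n \<longleftrightarrow> n > 0 \<and> (\<forall>p. prime p \<longrightarrow> p dvd n \<longrightarrow> p < k)"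

lemma rough_mult: "rough k a \<Longrightarrow> rough k b \<Longrightarrow> rough k (a * b)"
  by (auto simp: rough_def prime_dvd_mult_iff)

lemma smooth_dvd: "smooth k n \<Longrightarrow> d dvd n \<Longrightarrow> smooth k d"
  by (auto simp: smooth_def dvd_pos_nat intro: dvd_trans)

lemma smooth_mult: "smooth k a \<Longrightarrow> smooth k b \<Longrightarrow> smooth k (a * b)"
  by (auto simp: smooth_def prime_dvd_mult_iff)

lemma less_imp_smooth: "0 < j \<Longrightarrow> j < k \<Longrightarrow> smooth k j"
  by (auto simp: smooth_def dest: dvd_imp_le)

lemma rough_smooth_coprime:
  assumes "rough k a" "smooth k b"
  shows "coprime a b"
proof (rule ccontr)
  assume "\<not> coprime a b"
  then obtain p where "prime p" "p dvd a" "p dvd b"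
    by (metis coprime_iff_gcd_eq_1 gcd_dvd1 gcd_dvd2 prime_factor_nat dvd_trans)
  then show False using assms by (metis rough_def smooth_def not_le)
qed

text \<open>In a factorization into a rough and a smooth number the rough factor collects all prime factors
  from \<open>k\<close> on. Hence a number has at most one rough divisor with a cofactor below \<open>k\<close>.\<close>

lemma rough_factor_unique:
  assumes "rough k d" "rough k d'" "smooth k j" "smooth k j'" "d * j = d' * j'"
  shows "d = d'"
proof (rule dvd_antisym)
  have "d dvd d' * j'" using assms(5) by (metis dvd_triv_left)
  then show "d dvd d'" using rough_smooth_coprime[OF assms(1,4)] by (simp add: coprime_dvd_mult_left_iff)
  have "d' dvd d * j" using assms(5) by (metis dvd_triv_left)
  then show "d' dvd d" using rough_smooth_coprime[OF assms(2,3)] by (simp add: coprime_dvd_mult_left_iff)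
qed

lemma exists_rough_smooth_factorization:
  assumes "n > 0"
  shows "\<exists>e f. n = e * f \<and> rough k e \<and> smooth k f"
  using assms
proof (induction n rule: less_induct)
  case (less n)
  show ?case
  proof (cases "rough k n")
    case True
    then show ?thesis by (intro exI[of _ n] exI[of _ 1]) (auto simp: smooth_def)
  next
    case False
    then obtain p where p: "prime p" "p dvd n" "p < k"
      using less.prems by (auto simp: rough_def not_le)
    then obtain m where m: "n = p * m" by (auto elim: dvdE)
    have "m > 0" "m < n" using m less.prems prime_gt_1_nat[OF p(1)] by auto
    then obtain e f where "m = e * f" "rough k e" "smooth k f" using less.IH by blast
    moreover have "smooth k p" using p by (auto simp: smooth_def prime_gt_0_nat dest: dvd_imp_le)
    ultimately show ?thesis using m by (intro exI[of _ e] exI[of _ "p * f"]) (auto simp: smooth_mult)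
  qed
qed

section \<open>Reciprocal sums over smooth and rough numbers\<close>

lemma sum_reciprocal_powers_le:
  fixes x :: real
  assumes "0 \<le> x" "x \<le> 1 / 2"
  shows "(\<Sum>a=1..n. x ^ a) \<le> 2 * x"
proof (induction n)
  case 0
  then show ?case using assms by simp
next
  case (Suc n)
  have "(\<Sum>a=1..Suc n. x ^ a) = x + (\<Sum>a=1..n. x ^ Suc a)"
    by (subst sum.atLeast_Suc_atMost) (auto simp: sum.shift_bounds_cl_Suc_ivl simp del: sum.cl_ivl_Suc power_Suc)
  also have "\<dots> = x * (1 + (\<Sum>a=1..n. x ^ a))" by (simp add: sum_distrib_left algebra_simps)
  also have "\<dots> \<le> x * (1 + 2 * x)" using Suc assms by (intro mult_left_mono) auto
  also have "\<dots> \<le> x * 2" using assms by (intro mult_left_mono) auto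
  finally show ?case by simp
qed

text \<open>To be used for the smooth and for the non-rough numbers up to \<open>y\<close>: every prime power in
  either set is a power of a prime below \<open>k\<close>.\<close>

lemma sum_mangoldt_small_primes_le:
  fixes F :: "nat \<Rightarrow> real"
  assumes "Q \<subseteq> {1..y}" "\<And>q. F q \<ge> 0"
    and small: "\<And>p a. prime p \<Longrightarrow> a \<ge> 1 \<Longrightarrow> p ^ a \<in> Q \<Longrightarrow> p < k"
  shows "(\<Sum>q\<in>Q. mangoldt q * F q)
    \<le> (\<Sum>p | prime p \<and> p < k. \<Sum>a | a \<ge> 1 \<and> p ^ a \<le> y. ln (real p) * F (p ^ a))"
proof -
  let ?P = "{p. prime p \<and> p < k}"
  let ?I = "Sigma ?P (\<lambda>p. {a. a \<ge> 1 \<and> p ^ a \<le> y})"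
  have finA: "finite {a. a \<ge> 1 \<and> p ^ a \<le> y}" if "p \<in> ?P" for p
  proof (rule finite_subset)
    show "{a. a \<ge> 1 \<and> p ^ a \<le> y} \<subseteq> {..y}"
    proof
      fix a assume "a \<in> {a. a \<ge> 1 \<and> p ^ a \<le> y}"
      moreover have "a < p ^ a" using that by (intro power_gt_expt) (auto simp: prime_gt_Suc_0_nat prime_gt_1_nat)
      ultimately show "a \<in> {..y}" by simp
    qed
  qed simp
  then have finI: "finite ?I" by (intro finite_SigmaI) auto
  have finQ: "finite Q" using assms(1) finite_subset by blast
  have "(\<Sum>q\<in>Q. mangoldt q * F q) = (\<Sum>q | q \<in> Q \<and> primepow q. mangoldt q * F q)"
    using finQ by (intro sum.mono_neutral_right) (auto simp: mangoldt_def)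
  also have "\<dots> \<le> (\<Sum>(p,a)\<in>?I. ln (real p) * F (p ^ a))"
  proof (rule sum_le_included[where i = "\<lambda>(p,a). p ^ a"])
    show "finite {q \<in> Q. primepow q}" "finite ?I" using finQ finI by simp_all
    show "\<forall>i\<in>?I. 0 \<le> (case i of (p, a) \<Rightarrow> ln (real p) * F (p ^ a))"
      using assms(2) by (auto intro!: mult_nonneg_nonneg simp: prime_ge_1_nat prime_ge_Suc_0_nat)
    show "\<forall>q\<in>{q \<in> Q. primepow q}. \<exists>i\<in>?I. (case i of (p, a) \<Rightarrow> p ^ a) = q
        \<and> mangoldt q * F q \<le> (case i of (p, a) \<Rightarrow> ln (real p) * F (p ^ a))"
    proof
      fix q assume q: "q \<in> {q \<in> Q. primepow q}"
      then obtain p a where pa: "prime p" "a > 0" "q = p ^ a" by (auto simp: primepow_def)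
      then have "p < k" using q small[of p a] by auto
      moreover have "p ^ a \<le> y" using q pa assms(1) by auto
      ultimately show "\<exists>i\<in>?I. (case i of (p, a) \<Rightarrow> p ^ a) = q
        \<and> mangoldt q * F q \<le> (case i of (p, a) \<Rightarrow> ln (real p) * F (p ^ a))"
        using pa by (intro bexI[of _ "(p, a)"]) auto
    qed
  qed
  also have "\<dots> = (\<Sum>p\<in>?P. \<Sum>a | a \<ge> 1 \<and> p ^ a \<le> y. ln (real p) * F (p ^ a))"
    using finA by (intro sum.Sigma [symmetric]) auto
  finally show ?thesis .
qed

text \<open>Higher prime powers contribute a geometric series, which at most doubles the sum over primes.\<close>

lemma sum_mangoldt_over_smooth_le:
  assumes "k \<ge> 1"
  shows "(\<Sum>d | d \<in> {1..y} \<and> smooth k d. mangoldt d / real d) \<le> 4 * ln (real k)"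
proof -
  let ?P = "{p. prime p \<and> p < k}"
  have "(\<Sum>d | d \<in> {1..y} \<and> smooth k d. mangoldt d / real d)
      = (\<Sum>d | d \<in> {1..y} \<and> smooth k d. mangoldt d * (1 / real d))" by simp
  also have "\<dots> \<le> (\<Sum>p\<in>?P. \<Sum>a | a \<ge> 1 \<and> p ^ a \<le> y. ln (real p) * (1 / real (p ^ a)))"
    by (rule sum_mangoldt_small_primes_le) (auto simp: smooth_def Suc_le_eq)
  also have "\<dots> \<le> (\<Sum>p\<in>?P. 2 * (ln (real p) / real p))"
  proof (rule sum_mono)
    fix p assume p: "p \<in> ?P"
    then have p2: "p \<ge> 2" by (simp add: prime_ge_2_nat)
    have "{a. a \<ge> 1 \<and> p ^ a \<le> y} \<subseteq> {1..y}"
    proof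
      fix a assume "a \<in> {a. a \<ge> 1 \<and> p ^ a \<le> y}"
      moreover have "a < p ^ a" using p2 by (intro power_gt_expt) auto
      ultimately show "a \<in> {1..y}" by simp
    qed
    then have "(\<Sum>a | a \<ge> 1 \<and> p ^ a \<le> y. ln (real p) * (1 / real (p ^ a)))
       \<le> (\<Sum>a=1..y. ln (real p) * (1 / real (p ^ a)))"
      using p2 by (intro sum_mono2) auto
    also have "\<dots> = ln (real p) * (\<Sum>a=1..y. (1 / real p) ^ a)"
      by (simp add: sum_distrib_left power_one_over)
    also have "\<dots> \<le> ln (real p) * (2 * (1 / real p))"
      using p2 by (intro mult_left_mono sum_reciprocal_powers_le) (auto simp: field_simps)
    finally show "(\<Sum>a | a \<ge> 1 \<and> p ^ a \<le> y. ln (real p) * (1 / real (p ^ a))) \<le> 2 * (ln (real p) / real p)"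
      by (simp add: mult.commute)
  qed
  also have "\<dots> = 2 * (\<Sum>p\<in>?P. ln (real p) / real p)" by (simp add: sum_distrib_left)
  also have "\<dots> \<le> 4 * ln (real k)" using sum_ln_prime_over_prime_le[OF assms] by simp
  finally show ?thesis .
qed

lemma harm_le_1_plus_ln:
  assumes "n \<ge> 1"
  shows "(\<Sum>i=1..n. 1 / real i) \<le> 1 + ln (real n)"
  using assms
proof (induction n rule: dec_induct)
  case base
  then show ?case by simp
next
  case (step n)
  have "ln (real n / real (Suc n)) \<le> real n / real (Suc n) - 1"
    using step by (intro ln_le_minus_one) auto
  also have "\<dots> = - (1 / real (Suc n))" by (simp add: field_simps)
  finally have "1 / real (Suc n) \<le> ln (real (Suc n)) - ln (real n)"
    using step by (simp add: ln_div)
  then show ?case using step by simp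
qed

lemma ln_ge_two_thirds:
  assumes "k \<ge> 2"
  shows "ln (real k) \<ge> 2 / 3"
proof -
  have "ln 2 \<le> ln (real k)" using assms by (intro ln_mono) auto
  then show ?thesis using ln2_ge_two_thirds by linarith
qed

text \<open>The partial Euler product bound of Mertens. Let \<open>T\<close> be the sum in question. Give each smooth
  \<open>f \<le> y\<close> the weight \<open>1/f\<close>. Expanding \<open>ln f\<close> over the prime powers dividing \<open>f\<close> shows that
  the weighted sum of \<open>ln f\<close> is at most \<open>4 ln k \<cdot> T\<close>. By Markov's inequality at most half of the weight lies
  on \<open>f > k^8\<close>, and the rest is at most a harmonic sum up to \<open>k^8\<close>.\<close>

lemma sum_reciprocal_smooth_le:
  assumes "k \<ge> 2"
  shows "(\<Sum>f | f \<in> {1..y} \<and> smooth k f. 1 / real f) \<le> 20 * ln (real k)"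
proof -
  define S where "S = {f. f \<in> {1..y} \<and> smooth k f}"
  define T where "T = (\<Sum>f\<in>S. 1 / real f)"
  define L where "L = ln (real k)"
  have fin: "finite S" by (simp add: S_def)
  have L: "L \<ge> 2 / 3"
    unfolding L_def by (rule ln_ge_two_thirds[OF assms])
  have "(\<Sum>f\<in>S. ln (real f) / real f) = (\<Sum>f\<in>S. \<Sum>d | d dvd f. mangoldt d / real f)"
  proof (intro sum.cong refl)
    fix f assume "f \<in> S"
    then have "f \<noteq> 0" by (auto simp: S_def)
    then show "ln (real f) / real f = (\<Sum>d | d dvd f. mangoldt d / real f)"
      using mangoldt_sum[of f, where ?'a=real] by (simp add: sum_divide_distrib [symmetric])
  qed
  also have "\<dots> = (\<Sum>(f,d)\<in>Sigma S (\<lambda>f. {d. d dvd f}). mangoldt d / real f)"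
    using fin by (intro sum.Sigma) (auto simp: S_def)
  also have "\<dots> \<le> (\<Sum>(d,g)\<in>S \<times> S. mangoldt d / (real d * real g))"
  proof (rule sum_le_included[where i = "\<lambda>(d,g). (d * g, d)"])
    show "finite (Sigma S (\<lambda>f. {d. d dvd f}))"
      using fin by (intro finite_SigmaI) (auto simp: S_def)
    show "finite (S \<times> S)" using fin by simp
    show "\<forall>x\<in>S \<times> S. 0 \<le> (case x of (d, g) \<Rightarrow> mangoldt d / (real d * real g))"
      by (auto simp: mangoldt_nonneg)
    show "\<forall>x\<in>Sigma S (\<lambda>f. {d. d dvd f}). \<exists>y\<in>S \<times> S. (case y of (d, g) \<Rightarrow> (d * g, d)) = x
      \<and> (case x of (f, d) \<Rightarrow> mangoldt d / real f) \<le> (case y of (d, g) \<Rightarrow> mangoldt d / (real d * real g))"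
    proof
      fix x assume "x \<in> Sigma S (\<lambda>f. {d. d dvd f})"
      then obtain f d where f: "x = (f, d)" "f \<in> S" "d dvd f" by auto
      then obtain g where g: "f = d * g" by (auto elim: dvdE)
      then have "d \<le> f" "g \<le> f" using f by (auto simp: S_def smooth_def intro!: dvd_imp_le)
      have "f \<le> y" using f by (simp add: S_def)
      then have "d \<le> y" "g \<le> y" using \<open>d \<le> f\<close> \<open>g \<le> f\<close> by (blast intro: order.trans)+
      then have "d \<in> S" "g \<in> S"
        using f(2) smooth_dvd[of k f d] smooth_dvd[of k f g]
        unfolding S_def g by (auto simp: Suc_le_eq)
      then show "\<exists>y\<in>S \<times> S. (case y of (d, g) \<Rightarrow> (d * g, d)) = x
         \<and> (case x of (f, d) \<Rightarrow> mangoldt d / real f) \<le> (case y of (d, g) \<Rightarrow> mangoldt d / (real d * real g))"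
        using f(1) g by (intro bexI[of _ "(d, g)"]) auto
    qed
  qed
  also have "\<dots> = (\<Sum>d\<in>S. mangoldt d / real d) * T"
    by (simp add: T_def sum_product sum.cartesian_product)
  also have "\<dots> \<le> 4 * L * T"
    using sum_mangoldt_over_smooth_le[of k y] assms
    by (intro mult_right_mono) (auto simp: S_def L_def T_def intro!: sum_nonneg)
  finally have mean: "(\<Sum>f\<in>S. ln (real f) / real f) \<le> 4 * L * T" .
  \<comment> \<open>Markov's inequality: split at twice the bound \<open>4 ln k\<close> for the mean of \<open>ln f\<close>.\<close>
  define Lo where "Lo = {f\<in>S. f \<le> k ^ 8}"
  define Hi where "Hi = {f\<in>S. f > k ^ 8}"
  have "8 * L * (\<Sum>f\<in>Hi. 1 / real f) = (\<Sum>f\<in>Hi. ln (real k ^ 8) / real f)"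
    using assms by (simp add: sum_distrib_left L_def ln_realpow)
  also have "\<dots> \<le> (\<Sum>f\<in>Hi. ln (real f) / real f)"
  proof (intro sum_mono divide_right_mono)
    fix f assume "f \<in> Hi"
    then have "real (k ^ 8) \<le> real f" unfolding Hi_def by (subst of_nat_le_iff) auto
    then show "ln (real k ^ 8) \<le> ln (real f)" using assms by (intro ln_mono) auto
  qed auto
  also have "\<dots> \<le> (\<Sum>f\<in>S. ln (real f) / real f)"
    using fin by (intro sum_mono2) (auto simp: Hi_def S_def Suc_le_eq)
  also have "\<dots> \<le> 4 * L * T" by (rule mean)
  finally have "4 * L * (2 * (\<Sum>f\<in>Hi. 1 / real f)) \<le> 4 * L * T" by simp
  then have hi: "2 * (\<Sum>f\<in>Hi. 1 / real f) \<le> T" using L by (subst (asm) mult_le_cancel_left_pos) auto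
  have "(\<Sum>f\<in>Lo. 1 / real f) \<le> (\<Sum>f=1..k^8. 1 / real f)"
    by (intro sum_mono2) (auto simp: Lo_def S_def)
  also have "\<dots> \<le> 1 + ln (real (k ^ 8))" using assms by (intro harm_le_1_plus_ln) auto
  also have "\<dots> = 1 + 8 * L" using assms by (simp add: L_def ln_realpow)
  finally have lo: "(\<Sum>f\<in>Lo. 1 / real f) \<le> 1 + 8 * L" .
  have "S = Lo \<union> Hi" "Lo \<inter> Hi = {}" by (auto simp: Lo_def Hi_def)
  then have "T = (\<Sum>f\<in>Lo. 1 / real f) + (\<Sum>f\<in>Hi. 1 / real f)"
    unfolding T_def using fin by (metis sum.union_disjoint finite_Un)
  with hi lo L have "T \<le> 20 * L" by linarith
  then show ?thesis by (simp add: T_def S_def L_def)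
qed

text \<open>Every \<open>n \<le> y\<close> is a rough number times a smooth number, so the harmonic sum up to \<open>y\<close>
  is at most the product of the reciprocal sums over rough and over smooth numbers.\<close>

lemma sum_reciprocal_rough_ge:
  assumes "k \<ge> 2"
  shows "ln (real y + 1) / (20 * ln (real k)) \<le> (\<Sum>e | e \<in> {1..y} \<and> rough k e. 1 / real e)"
proof -
  define R where "R = {e. e \<in> {1..y} \<and> rough k e}"
  define S where "S = {f. f \<in> {1..y} \<and> smooth k f}"
  have L: "ln (real k) > 0" using assms by simp
  have "ln (real y + 1) \<le> harm y" by (rule ln_le_harm)
  also have "\<dots> = (\<Sum>n=1..y. 1 / real n)" by (simp add: harm_def inverse_eq_divide)
  also have "\<dots> \<le> (\<Sum>(e,f)\<in>R \<times> S. (1 / real e) * (1 / real f))"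
  proof (rule sum_le_included[where i = "\<lambda>(e,f). e * f"])
    show "\<forall>n\<in>{1..y}. \<exists>x\<in>R \<times> S. (case x of (e, f) \<Rightarrow> e * f) = n
      \<and> 1 / real n \<le> (case x of (e, f) \<Rightarrow> (1 / real e) * (1 / real f))"
    proof
      fix n assume n: "n \<in> {1..y}"
      then obtain e f where ef: "n = e * f" "rough k e" "smooth k f"
        using exists_rough_smooth_factorization[of n k] by auto
      have "e dvd n" "f dvd n" using ef by auto
      then have "e \<le> y" "f \<le> y" using n by (auto dest!: dvd_imp_le)
      then have "(e, f) \<in> R \<times> S" using ef by (auto simp: R_def S_def rough_def smooth_def Suc_le_eq)
      then show "\<exists>x\<in>R \<times> S. (case x of (e, f) \<Rightarrow> e * f) = n
        \<and> 1 / real n \<le> (case x of (e, f) \<Rightarrow> (1 / real e) * (1 / real f))"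
        using ef by (intro bexI[of _ "(e, f)"]) auto
    qed
  qed (auto simp: R_def S_def)
  also have "\<dots> = (\<Sum>e\<in>R. 1 / real e) * (\<Sum>f\<in>S. 1 / real f)"
    by (simp add: sum_product sum.cartesian_product)
  also have "\<dots> \<le> (\<Sum>e\<in>R. 1 / real e) * (20 * ln (real k))"
    using sum_reciprocal_smooth_le[OF assms, of y]
    by (intro mult_left_mono) (auto simp: S_def intro!: sum_nonneg)
  finally show ?thesis using L unfolding R_def by (subst pos_divide_le_eq) auto
qed

section \<open>Counting rough numbers\<close>

text \<open>Only the powers of the fewer than \<open>k\<close> primes below \<open>k\<close> are lost from \<open>\<psi>(y)\<close>, and
  each of these primes contributes at most \<open>ln y\<close>. The exponent 12 makes \<open>k ln y\<close> small
  compared with \<open>y\<close> already for \<open>k = 2\<close>.\<close>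

lemma sum_mangoldt_rough_ge:
  assumes "k \<ge> 2" "y \<ge> k ^ 12"
  shows "real y / 12 \<le> (\<Sum>q | q \<in> {1..y} \<and> rough k q. mangoldt q)"
proof -
  let ?P = "{p. prime p \<and> p < k}"
  define N where "N = {q. q \<in> {1..y} \<and> \<not> rough k q}"
  have y: "y \<ge> 2" using assms
    by (meson order.trans self_le_power zero_less_numeral one_le_numeral le_trans)
  have "(\<Sum>q\<in>N. mangoldt q) = (\<Sum>q\<in>N. mangoldt q * (1::real))" by simp
  also have "\<dots> \<le> (\<Sum>p\<in>?P. \<Sum>a | a \<ge> 1 \<and> p ^ a \<le> y. ln (real p) * 1)"
  proof (rule sum_mangoldt_small_primes_le)
    \<comment> \<open>A prime power that is not rough is a power of a prime below \<open>k\<close>.\<close>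
    fix p a :: nat assume pa: "prime p" "a \<ge> 1" "p ^ a \<in> N"
    then obtain r where "prime r" "r dvd p ^ a" "r < k"
      by (auto simp: N_def rough_def not_le)
    then show "p < k" using pa by (metis prime_dvd_power primes_dvd_imp_eq)
  qed (auto simp: N_def)
  also have "\<dots> \<le> (\<Sum>p\<in>?P. ln (real y))"
  proof (rule sum_mono)
    fix p assume p: "p \<in> ?P"
    then have p1: "p > 1" using prime_gt_1_nat by blast
    define b where "b = nat \<lfloor>ln (real y) / ln (real p)\<rfloor>"
    have "{a. a \<ge> 1 \<and> p ^ a \<le> y} \<subseteq> {1..b}"
    proof
      fix a assume a: "a \<in> {a. a \<ge> 1 \<and> p ^ a \<le> y}"
      then have "real (p ^ a) \<le> real y" by (subst of_nat_le_iff) auto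
      then have "ln (real p ^ a) \<le> ln (real y)" using p1 by (intro ln_mono) auto
      then have "real a \<le> ln (real y) / ln (real p)" using p1 by (simp add: ln_realpow field_simps)
      then show "a \<in> {1..b}" using a by (simp add: b_def le_nat_floor)
    qed
    then have "card {a. a \<ge> 1 \<and> p ^ a \<le> y} \<le> card {1..b}" by (intro card_mono) auto
    then have "real (card {a. a \<ge> 1 \<and> p ^ a \<le> y}) \<le> real b" by simp
    also have "\<dots> \<le> ln (real y) / ln (real p)" using p1 y by (simp add: b_def)
    finally show "(\<Sum>a | a \<ge> 1 \<and> p ^ a \<le> y. ln (real p) * 1) \<le> ln (real y)"
      using p1 by (simp add: field_simps)
  qed
  also have "\<dots> = real (card ?P) * ln (real y)" by simp
  also have "\<dots> \<le> real k * ln (real y)"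
  proof (intro mult_right_mono)
    have "card ?P \<le> card {..<k}" by (intro card_mono) auto
    then show "real (card ?P) \<le> real k" by simp
  qed (use y in auto)
  also have "\<dots> \<le> real y / 12"
  proof -
    have "real (k ^ 12) \<le> real y" using assms(2) by (subst of_nat_le_iff)
    then have "(real k ^ 6)\<^sup>2 \<le> real y" by (simp flip: power_mult)
    then have s: "sqrt (real y) \<ge> real k ^ 6" by (rule real_le_rsqrt)
    have "24 * real k \<le> real k ^ 5 * real k"
      using power_mono[of 2 "real k" 5] assms by (intro mult_right_mono) auto
    then have s: "24 * real k \<le> sqrt (real y)" using s by (simp add: power_numeral_reduce mult_ac)
    have "ln (real y) = 2 * ln (sqrt (real y))" using y by (simp add: ln_sqrt)
    also have "\<dots> \<le> 2 * sqrt (real y)" using y ln_le_minus_one[of "sqrt (real y)"] by simp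
    finally have "real k * ln (real y) \<le> real k * (2 * sqrt (real y))" by (intro mult_left_mono) auto
    also have "\<dots> = 24 * real k * sqrt (real y) / 12" by simp
    also have "\<dots> \<le> sqrt (real y) * sqrt (real y) / 12"
      using s by (intro divide_right_mono mult_right_mono) auto
    finally show ?thesis by simp
  qed
  finally have N: "(\<Sum>q\<in>N. mangoldt q) \<le> real y / 12" .
  have "(\<Sum>q=1..y. mangoldt q) = (\<Sum>q\<in>{q. q \<in> {1..y} \<and> rough k q} \<union> N. mangoldt q :: real)"
    by (intro sum.cong) (auto simp: N_def)
  also have "\<dots> = (\<Sum>q | q \<in> {1..y} \<and> rough k q. mangoldt q) + (\<Sum>q\<in>N. mangoldt q)"
    by (intro sum.union_disjoint) (auto simp: N_def)
  finally show ?thesis using chebyshev_lower[OF y] N by linarith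
qed

text \<open>The idea is Chebyshev's, applied to the rough numbers alone. Sum \<open>ln n\<close> over the rough
  \<open>n \<le> m\<close> in two ways. On the one hand the sum is at most the number of these \<open>n\<close> times \<open>ln m\<close>. On
  the other hand \<open>ln n\<close> is the sum of the von Mangoldt function over the divisors \<open>q\<close> of \<open>n\<close>;
  writing \<open>n = e q\<close>, where \<open>e\<close> and \<open>q\<close> are rough, the sum over \<open>q\<close> has order at least
  \<open>m / e\<close> by Chebyshev's bound if \<open>e \<le> m / k^12\<close>, and the sum of \<open>1/e\<close> over these \<open>e\<close> has
  order at least \<open>ln m / ln k\<close>. The factor \<open>ln m\<close>
  cancels.\<close>

lemma card_rough_ge:
  assumes k: "k \<ge> 2" and m: "m \<ge> k ^ 24"
  shows "real m / (960 * ln (real k)) \<le> real (card {d. d \<in> {1..m} \<and> rough k d})"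
proof -
  define R where "R = {d. d \<in> {1..m} \<and> rough k d}"
  define M where "M = m div k ^ 12"
  define RM where "RM = {e. e \<in> {1..M} \<and> rough k e}"
  define Q where "Q = (\<lambda>e. {q. q \<in> {1..m div e} \<and> rough k q})"
  have L: "ln (real k) > 0" using k by simp
  have m2: "m \<ge> 2" using k m
    by (meson order.trans self_le_power zero_less_numeral one_le_numeral le_trans)
  \<comment> \<open>As \<open>m \<ge> k^24\<close>, dividing by \<open>k^12\<close> at most halves the logarithm of \<open>m\<close>.\<close>
  have "m < k ^ 12 * (M + 1)"
    using dividend_less_times_div[of "k ^ 12" m] k by (simp add: M_def)
  then have "m * m < (k ^ 12 * (M + 1)) * (k ^ 12 * (M + 1))"
    by (meson mult_strict_mono' le0)
  also have "\<dots> = k ^ 24 * (M + 1)\<^sup>2" by (simp only: power2_eq_square mult_ac flip: power_add) simp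
  also have "\<dots> \<le> m * (M + 1)\<^sup>2" using m by (rule mult_right_mono) auto
  finally have "m < (M + 1)\<^sup>2" by simp
  then have "real m \<le> real ((M + 1)\<^sup>2)" by (subst of_nat_le_iff) auto
  then have "ln (real m) \<le> ln ((real M + 1)\<^sup>2)" using m2 by (intro ln_mono) (auto simp: add_ac)
  then have lnM: "ln (real m) \<le> 2 * ln (real M + 1)" by (simp add: ln_realpow)
  have "real m / 24 * (ln (real m) / (40 * ln (real k))) \<le> real m / 24 * (ln (real M + 1) / (20 * ln (real k)))"
    using lnM L by (intro mult_left_mono) (auto simp: field_simps)
  also have "\<dots> \<le> real m / 24 * (\<Sum>e\<in>RM. 1 / real e)"
    using sum_reciprocal_rough_ge[OF k, of M] by (intro mult_left_mono) (auto simp: RM_def)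
  also have "\<dots> = (\<Sum>e\<in>RM. real m / (24 * real e))" by (simp add: sum_distrib_left)
  also have "\<dots> \<le> (\<Sum>e\<in>RM. \<Sum>q\<in>Q e. mangoldt q)"
  proof (rule sum_mono)
    fix e assume "e \<in> RM"
    then have e: "e \<ge> 1" "e \<le> m div k ^ 12" by (auto simp: RM_def M_def)
    then have "e * k ^ 12 \<le> m" using k by (simp add: less_eq_div_iff_mult_less_eq)
    \<comment> \<open>The range of \<open>e\<close> is cut at \<open>M\<close> to leave room for \<open>q\<close>, as the Chebyshev-type bound demands.\<close>
    then have y: "k ^ 12 \<le> m div e" using e by (simp add: less_eq_div_iff_mult_less_eq mult.commute)
    moreover have "k ^ 12 \<ge> 1" using k by simp
    ultimately have y1: "m div e \<ge> 1" by linarith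
    have "m < e * (m div e + 1)" using dividend_less_times_div[of e m] e by simp
    also have "\<dots> \<le> e * (2 * (m div e))" using y1 by (intro mult_le_mono2) linarith
    finally have "real m \<le> real (e * (2 * (m div e)))" by (subst of_nat_le_iff) simp
    then have "real m / (24 * real e) \<le> real (m div e) / 12"
      using e by (simp add: field_simps)
    also have "\<dots> \<le> (\<Sum>q\<in>Q e. mangoldt q)"
      unfolding Q_def by (rule sum_mangoldt_rough_ge[OF k y])
    finally show "real m / (24 * real e) \<le> (\<Sum>q\<in>Q e. mangoldt q)" .
  qed
  also have "\<dots> = (\<Sum>(e,q)\<in>Sigma RM Q. mangoldt q)"
    by (intro sum.Sigma) (auto simp: RM_def Q_def)
  also have "\<dots> \<le> (\<Sum>(n,d)\<in>Sigma R (\<lambda>n. {d. d dvd n}). mangoldt d)"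
  proof (rule sum_le_included[where i = "\<lambda>(n,d). (n div d, d)"])
    show "finite (Sigma RM Q)" by (intro finite_SigmaI) (auto simp: RM_def Q_def)
    show "finite (Sigma R (\<lambda>n. {d. d dvd n}))" by (intro finite_SigmaI) (auto simp: R_def)
    show "\<forall>y\<in>Sigma R (\<lambda>n. {d. d dvd n}). (0 :: real) \<le> (case y of (n, d) \<Rightarrow> mangoldt d)"
      by (auto simp: mangoldt_nonneg)
    show "\<forall>x\<in>Sigma RM Q. \<exists>y\<in>Sigma R (\<lambda>n. {d. d dvd n}). (case y of (n, d) \<Rightarrow> (n div d, d)) = x
       \<and> (case x of (e, q) \<Rightarrow> mangoldt q) \<le> (case y of (n, d) \<Rightarrow> (mangoldt d :: real))"
    proof
      fix x assume "x \<in> Sigma RM Q"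
      then obtain e q where x: "x = (e, q)" "e \<in> RM" "q \<in> Q e" by auto
      then have eq: "e \<ge> 1" "q \<ge> 1" "q \<le> m div e" "rough k e" "rough k q"
        by (auto simp: RM_def Q_def)
      then have "e * q \<le> m" by (simp add: less_eq_div_iff_mult_less_eq mult.commute)
      then have "e * q \<in> R" using eq by (auto simp: R_def rough_mult Suc_le_eq)
      then show "\<exists>y\<in>Sigma R (\<lambda>n. {d. d dvd n}). (case y of (n, d) \<Rightarrow> (n div d, d)) = x
         \<and> (case x of (e, q) \<Rightarrow> mangoldt q) \<le> (case y of (n, d) \<Rightarrow> (mangoldt d :: real))"
        using x(1) eq by (intro bexI[of _ "(e * q, q)"]) auto
    qed
  qed
  also have "\<dots> = (\<Sum>n\<in>R. \<Sum>d | d dvd n. mangoldt d)"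
    by (intro sum.Sigma [symmetric]) (auto simp: R_def)
  also have "\<dots> = (\<Sum>n\<in>R. ln (real n))"
    using mangoldt_sum[where ?'a=real] by (intro sum.cong) (auto simp: R_def)
  also have "\<dots> \<le> (\<Sum>n\<in>R. ln (real m))"
    by (intro sum_mono ln_mono) (auto simp: R_def)
  finally have "real m / (960 * ln (real k)) * ln (real m) \<le> real (card R) * ln (real m)" by simp
  then show ?thesis using m2 unfolding R_def by (subst (asm) mult_le_cancel_right_pos) auto
qed

section \<open>Weights on the common differences\<close>

text \<open>The arithmetic core: weights on the common differences \<open>d \<le> m\<close> of total mass at least of
  order \<open>m / ln k\<close>
  such that, for each \<open>D\<close>, the differences of progressions of \<open>k\<close> terms that can contain two
  points at distance \<open>D\<close> have mass at most 1.

  If \<open>m\<close> is at most a fixed power of \<open>k\<close>, the von Mangoldt function divided by a multiple of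
  \<open>ln k\<close> works: its sum over all divisors of \<open>D\<close> is \<open>ln D\<close>, which is \<open>O(ln k)\<close>, and its
  total mass is given by Chebyshev's bound. For larger \<open>m\<close> this would lose a factor \<open>ln m / ln k\<close>;
  then the indicator function of the rough numbers works, as the rough divisor of \<open>D\<close> in question
  is unique. Below \<open>k\<close> there are no rough numbers but 1, so that the second choice cannot replace
  the first.\<close>

lemma exists_difference_weights:
  assumes k: "k \<ge> 2" and m: "m \<ge> 2" and n: "n < 2 * k * (m + 1)"
  shows "\<exists>w :: nat \<Rightarrow> real. (\<forall>d. w d \<ge> 0) \<and> real m / (960 * ln (real k)) \<le> (\<Sum>d=1..m. w d)
     \<and> (\<forall>D. 0 < D \<longrightarrow> D < n \<longrightarrow> (\<Sum>d | d \<in> {1..m} \<and> d dvd D \<and> D div d < k. w d) \<le> 1)"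
proof (cases "m \<le> k ^ 24")
  case True
  have L: "ln (real k) > 0" using k by simp
  have "2 * k * (m + 1) \<le> 2 * k * (2 * m)" using m by (intro mult_le_mono2) linarith
  also have "\<dots> = 4 * (k * m)" by simp
  also have "\<dots> \<le> k ^ 2 * (k * k ^ 24)"
    using power_mono[of 2 k 2] k True by (intro mult_le_mono) auto
  also have "\<dots> = k ^ 27" by (simp add: power_numeral_reduce mult_ac)
  finally have n27: "n \<le> k ^ 27" using n by linarith
  define B where "B = 27 * ln (real k)"
  have B: "B > 0" using L by (simp add: B_def)
  \<comment> \<open>\<open>B\<close> bounds \<open>ln D\<close> for all \<open>D < n\<close>, so it normalizes divisor sums to at most 1.\<close>
  show ?thesis
  proof (intro exI[of _ "\<lambda>d. mangoldt d / B"] conjI allI impI)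
    show "mangoldt d / B \<ge> 0" for d using B by (simp add: mangoldt_nonneg)
    have "real m / (960 * ln (real k)) \<le> (real m / 6) / B"
      using L by (simp add: B_def field_simps)
    also have "\<dots> \<le> (\<Sum>d=1..m. mangoldt d) / B"
      using chebyshev_lower[OF m] B by (intro divide_right_mono) auto
    finally show "real m / (960 * ln (real k)) \<le> (\<Sum>d=1..m. mangoldt d / B)"
      by (simp add: sum_divide_distrib)
    fix D assume D: "0 < D" "D < n"
    have "(\<Sum>d | d \<in> {1..m} \<and> d dvd D \<and> D div d < k. mangoldt d) \<le> (\<Sum>d | d dvd D. mangoldt d :: real)"
      using D by (intro sum_mono2) (auto simp: mangoldt_nonneg)
    also have "\<dots> = ln (real D)" using mangoldt_sum[of D, where ?'a=real] D by simp
    also have "\<dots> \<le> ln (real (k ^ 27))"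
      using D n27 by (intro ln_mono) (auto simp del: of_nat_power)
    also have "\<dots> = B" using k by (simp add: B_def ln_realpow)
    finally show "(\<Sum>d | d \<in> {1..m} \<and> d dvd D \<and> D div d < k. mangoldt d / B) \<le> 1"
      using B by (simp flip: sum_divide_distrib)
  qed
next
  case False
  define w where "w = (\<lambda>d. if rough k d then 1 else 0 :: real)"
  show ?thesis
  proof (intro exI[of _ w] conjI allI impI)
    show "w d \<ge> 0" for d by (simp add: w_def)
    have "(\<Sum>d=1..m. w d) = real (card {d. d \<in> {1..m} \<and> rough k d})"
      by (simp add: w_def sum.If_cases Int_def)
    then show "real m / (960 * ln (real k)) \<le> (\<Sum>d=1..m. w d)"
      using card_rough_ge[OF k, of m] False by simp
    fix D assume D: "0 < D" "D < n"
    define X where "X = {d. d \<in> {1..m} \<and> d dvd D \<and> D div d < k}"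
    have "(\<Sum>d\<in>X. w d) = real (card {d\<in>X. rough k d})"
      by (simp add: w_def sum.If_cases Int_def X_def)
    also have "card {d\<in>X. rough k d} \<le> 1"
    proof -
      have "d = d'" if "d \<in> X" "rough k d" "d' \<in> X" "rough k d'" for d d'
      proof (rule rough_factor_unique)
        show "smooth k (D div d)" "smooth k (D div d')"
          using that D by (auto simp: X_def intro!: less_imp_smooth Nat.gr0I)
        show "d * (D div d) = d' * (D div d')" using that by (auto simp: X_def)
      qed (use that in auto)
      then show ?thesis by (auto simp: card_le_Suc0_iff_eq X_def)
    qed
    finally show "(\<Sum>d | d \<in> {1..m} \<and> d dvd D \<and> D div d < k. w d) \<le> 1"
      by (simp add: X_def)
  qed
qed

section \<open>Counting progressions through an edge\<close>

text \<open>If a progression \<open>a, a + d, \<dots>, a + (k - 1) d\<close> contains both \<open>x\<close> and \<open>y\<close>, then \<open>d\<close> divides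
  \<open>y - x\<close> with a quotient below \<open>k\<close>. For such a \<open>d\<close> there are at most \<open>k\<close> starting points
  \<open>a\<close>, one for each position of \<open>x\<close>.\<close>

lemma weighted_progressions_through_pair_le:
  fixes w :: "nat \<Rightarrow> real"
  assumes w: "\<And>d. w d \<ge> 0" and xy: "x < y"
    and W: "(\<Sum>d | d \<in> {1..m} \<and> d dvd (y - x) \<and> (y - x) div d < k. w d) \<le> 1"
  shows "(\<Sum>d=1..m. w d * real (card {a\<in>{1..h}. {x, y} \<subseteq> {a + i * d | i. i < k}})) \<le> real k"
proof -
  let ?A = "\<lambda>d. {a\<in>{1..h}. {x, y} \<subseteq> {a + i * d | i. i < k}}"
  let ?X = "{d. d \<in> {1..m} \<and> d dvd (y - x) \<and> (y - x) div d < k}"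
  have "(\<Sum>d=1..m. w d * real (card (?A d))) \<le> (\<Sum>d\<in>?X. w d * real (card (?A d)))"
  proof -
    have empty: "?A d = {}" if d: "d \<in> {1..m} - ?X" for d
    proof (rule ccontr)
      assume "?A d \<noteq> {}"
      then obtain a i j where ij: "i < k" "j < k" "x = a + i * d" "y = a + j * d" by auto
      then have "y - x = (j - i) * d" by (simp add: diff_mult_distrib)
      then show False using d ij by auto
    qed
    have "w d * real (card (?A d)) = 0" if "d \<in> {1..m} - ?X" for d
      by (simp only: empty[OF that] card.empty of_nat_0 mult_zero_right)
    then show ?thesis
      by (intro eq_refl [OF sum.mono_neutral_right] ballI) auto
  qed
  also have "\<dots> \<le> (\<Sum>d\<in>?X. w d * real k)"
  proof (intro sum_mono mult_left_mono w)
    fix d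
    have "?A d \<subseteq> (\<lambda>i. x - i * d) ` {..<k}"
    proof
      fix a assume "a \<in> ?A d"
      then obtain i where "i < k" "x = a + i * d" by auto
      then show "a \<in> (\<lambda>i. x - i * d) ` {..<k}" by (intro image_eqI[of _ _ i]) auto
    qed
    then have "card (?A d) \<le> card ((\<lambda>i. x - i * d) ` {..<k})" by (intro card_mono) auto
    also have "\<dots> \<le> k" using card_image_le[of "{..<k}" "\<lambda>i. x - i * d"] by simp
    finally show "real (card (?A d)) \<le> real k" by simp
  qed
  also have "\<dots> = (\<Sum>d\<in>?X. w d) * real k" by (simp add: sum_distrib_right)
  also have "\<dots> \<le> 1 * real k" using W by (intro mult_right_mono) auto
  finally show ?thesis by simp
qed

text \<open>Weighted double counting of the pairs of a progression and an edge contained in it. The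
  progressions start in the lower half \<open>{1..h}\<close> of the vertex set and span at most the other half,
  so they stay inside the vertex set. Each of them contains an edge, and by the previous lemma the
  progressions through a given edge have total weight at most \<open>k\<close>.\<close>

lemma edges_ge_if_no_independent_progression:
  fixes w :: "nat \<Rightarrow> real"
  assumes E: "E \<subseteq> nsets {1..n} 2"
    and none: "\<nexists>A. independent_progression n k E A"
    and m: "2 * k * m \<le> n"
    and w: "\<And>d. w d \<ge> 0"
    and W: "\<And>D. 0 < D \<Longrightarrow> D < n \<Longrightarrow> (\<Sum>d | d \<in> {1..m} \<and> d dvd D \<and> D div d < k. w d) \<le> 1"
  shows "real n / 2 * (\<Sum>d=1..m. w d) \<le> real (card E) * real k"
proof -
  define h where "h = n - n div 2"
  let ?AP = "\<lambda>a d. {a + i * d | i. i < k}"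
  have "finite (nsets {1..n} 2)" by (simp add: finite_imp_finite_nsets)
  then have finE: "finite E" using E finite_subset by blast
  have hit: "\<exists>e\<in>E. e \<subseteq> ?AP a d" if "a \<in> {1..h}" "d \<in> {1..m}" for a d
  proof -
    have "?AP a d \<subseteq> {1..n}"
    proof
      fix x assume "x \<in> ?AP a d"
      then obtain i where i: "i < k" "x = a + i * d" by auto
      then have "i * d \<le> k * m" using that by (intro mult_le_mono) auto
      moreover have "k * m \<le> n div 2" using m by (simp add: less_eq_div_iff_mult_less_eq mult_ac)
      moreover have "a \<le> n - n div 2" using that by (simp add: h_def)
      ultimately show "x \<in> {1..n}" using i that by simp
    qed
    moreover have "arith_progression k (?AP a d)"
      unfolding arith_progression_def using that by auto
    ultimately have "\<not> indep (?AP a d) E"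
      using none unfolding independent_progression_def by blast
    then obtain u v where uv: "u \<in> ?AP a d" "v \<in> ?AP a d" "{u, v} \<in> E"
      unfolding indep_def by blast
    then show ?thesis by (intro bexI[of _ "{u, v}"]) auto
  qed
  have "real n / 2 * (\<Sum>d=1..m. w d) \<le> real h * (\<Sum>d=1..m. w d)"
    using w by (intro mult_right_mono sum_nonneg) (auto simp: h_def)
  also have "\<dots> = (\<Sum>d=1..m. w d * real (card {1..h}))"
    by (simp add: sum_distrib_left mult.commute)
  also have "\<dots> \<le> (\<Sum>d=1..m. w d * (\<Sum>e\<in>E. real (card {a\<in>{1..h}. e \<subseteq> ?AP a d})))"
  proof (intro sum_mono mult_left_mono w)
    fix d assume d: "d \<in> {1..m}"
    have "card {1..h} \<le> card (\<Union>e\<in>E. {a\<in>{1..h}. e \<subseteq> ?AP a d})"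
      using hit[OF _ d] finE by (intro card_mono) auto
    also have "\<dots> \<le> (\<Sum>e\<in>E. card {a\<in>{1..h}. e \<subseteq> ?AP a d})"
      by (rule card_UN_le[OF finE])
    finally show "real (card {1..h}) \<le> (\<Sum>e\<in>E. real (card {a\<in>{1..h}. e \<subseteq> ?AP a d}))"
      by (simp only: of_nat_le_iff flip: of_nat_sum)
  qed
  also have "\<dots> = (\<Sum>e\<in>E. \<Sum>d=1..m. w d * real (card {a\<in>{1..h}. e \<subseteq> ?AP a d}))"
    by (subst sum.swap) (simp add: sum_distrib_left)
  also have "\<dots> \<le> (\<Sum>e\<in>E. real k)"
  proof (rule sum_mono)
    fix e assume "e \<in> E"
    then have "e \<in> nsets {1..n} 2" using E by auto
    then obtain x y where xy: "e = {x, y}" "x \<in> {1..n}" "y \<in> {1..n}" "x < y"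
      by (elim nsets2_E) (metis insert_commute linorder_neqE_nat)
    show "(\<Sum>d=1..m. w d * real (card {a\<in>{1..h}. e \<subseteq> ?AP a d})) \<le> real k"
      unfolding xy(1)
      by (rule weighted_progressions_through_pair_le[OF w xy(4) W]) (use xy in auto)
  qed
  finally show ?thesis by simp
qed

theorem theorem2p2:
  shows "\<exists>\<epsilon>::real. \<epsilon> > 0 \<and>
    (\<forall>(n::nat) (k::nat) (E :: nat set set).
       n \<ge> k \<longrightarrow> k \<ge> 2 \<longrightarrow> E \<subseteq> nsets {1..n} 2 \<longrightarrow>
       real (card E) < \<epsilon> * (real n ^ 2 / (real k ^ 2 * ln (real k))) \<longrightarrow>
       (\<exists>A. independent_progression n k E A))"
\<comment> \<open>\<open>7680 = 2 \<cdot> 4 \<cdot> 960\<close>: half of the starting points, the loss \<open>m \<ge> n / (4 k)\<close> from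
  rounding, and the constant of the weights.\<close>
proof (rule exI[of _ "1/7680"], intro conjI allI impI)
  show "(1/7680::real) > 0" by simp
  fix n k :: nat and E :: "nat set set"
  assume nk: "n \<ge> k" and k: "k \<ge> 2" and E: "E \<subseteq> nsets {1..n} 2"
    and few: "real (card E) < 1/7680 * (real n ^ 2 / (real k ^ 2 * ln (real k)))"
  define m where "m = n div (2 * k)"
  have lnk: "ln (real k) \<ge> 2 / 3"
    by (rule ln_ge_two_thirds[OF k])
  have "n < 2 * k * (m + 1)"
    using dividend_less_times_div[of "2 * k" n] k by (simp add: m_def)
  show "\<exists>A. independent_progression n k E A"
  proof (cases "m \<ge> 2")
    case True
    have mn: "2 * k * m \<le> n" by (simp add: m_def)
    obtain w :: "nat \<Rightarrow> real" where w: "\<And>d. w d \<ge> 0"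
        "real m / (960 * ln (real k)) \<le> (\<Sum>d=1..m. w d)"
        "\<And>D. 0 < D \<Longrightarrow> D < n \<Longrightarrow> (\<Sum>d | d \<in> {1..m} \<and> d dvd D \<and> D div d < k. w d) \<le> 1"
      using exists_difference_weights[OF k True \<open>n < 2 * k * (m + 1)\<close>] by blast
    show ?thesis
    proof (rule ccontr)
      assume none: "\<nexists>A. independent_progression n k E A"
      have "n \<le> 2 * k * (2 * m)"
        using \<open>n < 2 * k * (m + 1)\<close> mult_le_mono2[of "m + 1" "2 * m" "2 * k"] True by linarith
      then have "real n \<le> real (2 * k * (2 * m))" by (subst of_nat_le_iff)
      then have m_ge: "real n / (4 * real k) \<le> real m" using k by (simp add: field_simps)
      have "real n / 2 * (real n / (4 * real k) / (960 * ln (real k)))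
          \<le> real n / 2 * (real m / (960 * ln (real k)))"
        using m_ge lnk by (intro mult_left_mono divide_right_mono) auto
      also have "\<dots> \<le> real n / 2 * (\<Sum>d=1..m. w d)" using w(2) by (intro mult_left_mono) auto
      also have "\<dots> \<le> real (card E) * real k"
        by (rule edges_ge_if_no_independent_progression[OF E none mn w(1,3)])
      also have "\<dots> < 1/7680 * (real n ^ 2 / (real k ^ 2 * ln (real k))) * real k"
        using few k by (intro mult_strict_right_mono) auto
      also have "\<dots> = real n / 2 * (real n / (4 * real k) / (960 * ln (real k)))"
        using k lnk by (simp add: field_simps power2_eq_square)
      finally show False by simp
    qed
  next
    case False
    \<comment> \<open>Here \<open>n < 4 k\<close>, and the bound on the number of edges is below 1, so the graph has no edges.\<close>
    then have "2 * k * (m + 1) \<le> 2 * k * 2" by (intro mult_le_mono2) linarith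
    then have "real n \<le> real (4 * k)" using \<open>n < 2 * k * (m + 1)\<close> by (subst of_nat_le_iff) linarith
    then have "real n ^ 2 \<le> (4 * real k) ^ 2" by (intro power_mono) auto
    then have "real n ^ 2 / (real k ^ 2 * ln (real k)) \<le> 16 * real k ^ 2 / (real k ^ 2 * ln (real k))"
      using lnk by (intro divide_right_mono) (auto simp: power_mult_distrib)
    also have "\<dots> = 16 / ln (real k)" using k by simp
    also have "\<dots> \<le> 24" using lnk by (simp add: field_simps)
    finally have "real (card E) < 1" using few by linarith
    moreover have "finite E"
      using E by (meson finite_atLeastAtMost finite_imp_finite_nsets finite_subset)
    ultimately have "E = {}" by simp
    moreover have "arith_progression k {1..k}"
      unfolding arith_progression_def
      by (rule exI[of _ 1], rule exI[of _ 1]) (auto simp: Suc_le_eq gr0_conv_Suc)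
    ultimately have "independent_progression n k E {1..k}"
      using nk by (auto simp: independent_progression_def indep_def)
    then show ?thesis by blast
  qed
qed

end
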